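(* Let $a\in\mathbb R$, $a\ne0$, $\delta>0$, let $M\ge1$ be an integer, and let $(x_n)_{0\le n\le M}$ be the Markov chain $$x_n=e^{a\delta}x_{n-1}+w_n,\qquad 1\le n\le M,$$ where $w_1,\dots,w_M$ are i.i.d. $\mathcal N\!\left(0,\frac{e^{2a\delta}-1}{2a}\right)$, independent of $x_0$. For $0\le n\le M$ and $x\in\mathbb R$ let $$V_n^1(x)=\sup_{n\le\nu\le M}\mathbb E\left[x_\nu^2\,\frac{e^{2a\delta(M-\nu)}-1}{2a}\,\Big|\,x_n=x\right],$$ the supremum being over stopping times $\nu$ with values in $\{n,\dots,M\}$. Then $V_M^1\equiv0$, and for $n=M-1,\dots,0$ $$V_n^1(x)=\max\left\{x^2\,\frac{e^{2a\delta(M-n)}-1}{2a},\ \mathbb E\left[V_{n+1}^1(x_{n+1})\,|\,x_n=x\right]\right\}.$$ Moreover the optimal policy is a time-varying threshold policy: for every $n$ there exists a threshold $\lambda_n\ge0$ such that it is optimal at time $n$ (if no sample has been taken before) to stop and sample if $|x_n|\ge\lambda_n$ and to continue to time $n+1$ if $|x_n|<\lambda_n$.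
   Context: This is the time-discretized single-sample optimal sampling problem for the Ornstein–Uhlenbeck process $dx_t=ax_t\,dt+dW_t$, with time step $\delta$; stopping times are with respect to the filtration generated by $(x_n)$. "It is optimal to stop" at $(n,x)$ means that the first term in the maximum is at least the second one; "it is optimal to continue" means that the second term is at least the first. At $n=M$ one must stop (the reward there is $0$). *)

theory Defs
  imports "HOL-Probability.Probability"
begin

locale ou_chain = prob_space P
  for P :: "'a measure" +
  fixes a \<delta> :: real and M :: nat and X w :: "nat \<Rightarrow> 'a \<Rightarrow> real"
  assumes a_nonzero: "a \<noteq> 0"
    and step_pos: "0 < \<delta>"
    and horizon_pos: "1 \<le> M"
    and noise_normal: "\<And>k. 1 \<le> k \<Longrightarrow> k \<le> M \<Longrightarrow>
      distributed P lborel (w k) (normal_density 0 (sqrt ((exp (2 * a * \<delta>) - 1) / (2 * a))))"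
    \<comment> \<open>joint independence of \<open>X 0, w 1, \<dots>, w M\<close>\<close>
    and indep: "indep_vars (\<lambda>_. borel) (\<lambda>k. if k = 0 then X 0 else w k) {0..M}"
    and recursion: "\<And>k \<omega>. 1 \<le> k \<Longrightarrow> k \<le> M \<Longrightarrow> \<omega> \<in> space P \<Longrightarrow>
      X k \<omega> = exp (a * \<delta>) * X (k - 1) \<omega> + w k \<omega>"

definition sampling_reward :: "real \<Rightarrow> real \<Rightarrow> nat \<Rightarrow> nat \<Rightarrow> real \<Rightarrow> real" where
  "sampling_reward a \<delta> M k x = x\<^sup>2 * ((exp (2 * a * \<delta> * (real M - real k)) - 1) / (2 * a))"

text \<open>The chain restarted from the value \<open>x\<close> at time \<open>n\<close> and driven by the same noise.
  Coordinates before \<open>n\<close> carry no information; they are never observed below.\<close>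

primrec ou_path :: "real \<Rightarrow> real \<Rightarrow> (nat \<Rightarrow> 'a \<Rightarrow> real) \<Rightarrow> nat \<Rightarrow> real \<Rightarrow> nat \<Rightarrow> 'a \<Rightarrow> real" where
  "ou_path a \<delta> w n x 0 \<omega> = x"
| "ou_path a \<delta> w n x (Suc k) \<omega> =
     (if Suc k \<le> n then x else exp (a * \<delta>) * ou_path a \<delta> w n x k \<omega> + w (Suc k) \<omega>)"

text \<open>\<open>\<E>[f(x\<^sub>n, x\<^sub>n\<^sub>+\<^sub>1, \<dots>) | x\<^sub>n = x]\<close> for a path functional \<open>f\<close>. A conditional expectation given
  \<open>x\<^sub>n\<close> determines a function of \<open>x\<close> only almost everywhere; here it is the version given, at every
  \<open>x\<close>, by the transition law of the chain. Lemma \<open>expectation_from_version\<close> shows that it is a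
  version.\<close>

definition expectation_from ::
    "'a measure \<Rightarrow> real \<Rightarrow> real \<Rightarrow> (nat \<Rightarrow> 'a \<Rightarrow> real) \<Rightarrow> nat \<Rightarrow> real \<Rightarrow> ((nat \<Rightarrow> real) \<Rightarrow> real) \<Rightarrow> real" where
  "expectation_from P a \<delta> w n x f = (\<integral>\<omega>. f (\<lambda>k. ou_path a \<delta> w n x k \<omega>) \<partial>P)"

text \<open>The \<open>\<sigma>\<close>-algebra generated by the coordinates \<open>x\<^sub>n, \<dots>, x\<^sub>k\<close> on path space. Stopping times are
  functionals of the path. Given \<open>x\<^sub>n = x\<close>, the values before time \<open>n\<close> are independent of the
  future of the chain, and the problem started at \<open>(n, x)\<close> observes the chain from time \<open>n\<close> on.\<close>

definition path_filtration :: "nat \<Rightarrow> nat \<Rightarrow> (nat \<Rightarrow> real) measure" where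
  "path_filtration n k =
     vimage_algebra UNIV (\<lambda>y. restrict y {n..k}) (\<Pi>\<^sub>M j\<in>{n..k}. (borel :: real measure))"

definition stopping_times :: "nat \<Rightarrow> nat \<Rightarrow> ((nat \<Rightarrow> real) \<Rightarrow> nat) set" where
  "stopping_times n M =
     {\<nu>. stopping_time (path_filtration n) \<nu> \<and> (\<forall>y. n \<le> \<nu> y \<and> \<nu> y \<le> M)}"

definition stopping_values ::
    "'a measure \<Rightarrow> real \<Rightarrow> real \<Rightarrow> nat \<Rightarrow> (nat \<Rightarrow> 'a \<Rightarrow> real) \<Rightarrow> nat \<Rightarrow> real \<Rightarrow> real set" where
  "stopping_values P a \<delta> M w n x =
     (\<lambda>\<nu>. expectation_from P a \<delta> w n x (\<lambda>y. sampling_reward a \<delta> M (\<nu> y) (y (\<nu> y)))) `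
       stopping_times n M"

definition value_fun ::
    "'a measure \<Rightarrow> real \<Rightarrow> real \<Rightarrow> nat \<Rightarrow> (nat \<Rightarrow> 'a \<Rightarrow> real) \<Rightarrow> nat \<Rightarrow> real \<Rightarrow> real" where
  "value_fun P a \<delta> M w n x = Sup (stopping_values P a \<delta> M w n x)"

definition continuation_value ::
    "'a measure \<Rightarrow> real \<Rightarrow> real \<Rightarrow> nat \<Rightarrow> (nat \<Rightarrow> 'a \<Rightarrow> real) \<Rightarrow> nat \<Rightarrow> real \<Rightarrow> real" where
  "continuation_value P a \<delta> M w n x =
     expectation_from P a \<delta> w n x (\<lambda>y. value_fun P a \<delta> M w (Suc n) (y (Suc n)))"

text \<open>At the horizon stopping is forced.\<close>

definition optimal_to_stop ::
    "'a measure \<Rightarrow> real \<Rightarrow> real \<Rightarrow> nat \<Rightarrow> (nat \<Rightarrow> 'a \<Rightarrow> real) \<Rightarrow> nat \<Rightarrow> real \<Rightarrow> bool" where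
  "optimal_to_stop P a \<delta> M w n x \<longleftrightarrow>
     n = M \<or> n < M \<and> continuation_value P a \<delta> M w n x \<le> sampling_reward a \<delta> M n x"

definition optimal_to_continue ::
    "'a measure \<Rightarrow> real \<Rightarrow> real \<Rightarrow> nat \<Rightarrow> (nat \<Rightarrow> 'a \<Rightarrow> real) \<Rightarrow> nat \<Rightarrow> real \<Rightarrow> bool" where
  "optimal_to_continue P a \<delta> M w n x \<longleftrightarrow>
     n < M \<and> sampling_reward a \<delta> M n x \<le> continuation_value P a \<delta> M w n x"


subsection \<open>The definitions are meaningful\<close>

lemma space_path_filtration [simp]: "space (path_filtration n k) = UNIV"
  by (simp add: path_filtration_def)

lemma ou_path_before: "k \<le> n \<Longrightarrow> ou_path a \<delta> w n x k \<omega> = x"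
  by (cases k) auto

lemma measurable_into_path_filtration:
  assumes "\<And>j. j \<in> {n..k} \<Longrightarrow> (\<lambda>z. g z j) \<in> borel_measurable N"
  shows "g \<in> N \<rightarrow>\<^sub>M path_filtration n k"
  unfolding path_filtration_def
  by (rule measurable_vimage_algebra2) (auto intro!: measurable_restrict assms)

lemma path_filtration_mono:
  assumes "k \<le> m"
  shows "sets (path_filtration n k) \<subseteq> sets (path_filtration n m)"
proof -
  have "(\<lambda>y. y) \<in> path_filtration n m \<rightarrow>\<^sub>M path_filtration n k"
  proof (rule measurable_into_path_filtration)
    fix j assume j: "j \<in> {n..k}"
    have "(\<lambda>y. restrict y {n..m}) \<in> path_filtration n m \<rightarrow>\<^sub>M (\<Pi>\<^sub>M j\<in>{n..m}. (borel :: real measure))"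
      unfolding path_filtration_def by (rule measurable_vimage_algebra1) (auto simp: space_PiM)
    moreover have "j \<in> {n..m}" using j assms by auto
    ultimately have "(\<lambda>y. restrict y {n..m} j) \<in> borel_measurable (path_filtration n m)"
      by (rule measurable_component_singleton[THEN measurable_compose_rev, rotated])
    then show "(\<lambda>y. y j) \<in> borel_measurable (path_filtration n m)"
      using \<open>j \<in> {n..m}\<close> by simp
  qed
  then show ?thesis by (auto dest!: measurable_sets)
qed

lemma path_filtration_depends:
  fixes f :: "(nat \<Rightarrow> real) \<Rightarrow> real"
  assumes f: "f \<in> borel_measurable (path_filtration n k)"
    and eq: "\<And>j. j \<in> {n..k} \<Longrightarrow> y j = z j"
  shows "f y = f z"
proof -
  have "f -` {f y} \<inter> space (path_filtration n k) \<in> sets (path_filtration n k)"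
    by (rule measurable_sets[OF f]) auto
  then obtain A where A: "f -` {f y} = (\<lambda>y. restrict y {n..k}) -` A"
    unfolding path_filtration_def by (subst (asm) sets_vimage_algebra2) (auto simp: space_PiM)
  have "restrict y {n..k} = restrict z {n..k}"
    using eq by (auto simp: restrict_def fun_eq_iff)
  moreover have "y \<in> f -` {f y}" by simp
  ultimately have "z \<in> f -` {f y}" unfolding A by simp
  then show ?thesis by simp
qed

context ou_chain
begin

lemma X0_measurable [measurable]: "X 0 \<in> borel_measurable P"
  using indep unfolding indep_vars_def by (auto dest!: bspec[of _ _ 0])

lemma w_measurable: "1 \<le> k \<Longrightarrow> k \<le> M \<Longrightarrow> w k \<in> borel_measurable P"
  using noise_normal[of k] by (auto simp: distributed_def)

lemma X_measurable: "k \<le> M \<Longrightarrow> X k \<in> borel_measurable P"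
proof (induction k)
  case (Suc k)
  then have [measurable]: "X k \<in> borel_measurable P" "w (Suc k) \<in> borel_measurable P"
    by (auto intro: w_measurable)
  have "X (Suc k) \<in> borel_measurable P \<longleftrightarrow>
    (\<lambda>\<omega>. exp (a * \<delta>) * X k \<omega> + w (Suc k) \<omega>) \<in> borel_measurable P"
    by (intro measurable_cong) (use recursion[of "Suc k"] Suc.prems in auto)
  then show ?case by simp
qed (rule X0_measurable)

lemma ou_path_measurable: "k \<le> M \<Longrightarrow> (\<lambda>\<omega>. ou_path a \<delta> w n x k \<omega>) \<in> borel_measurable P"
proof (induction k)
  case (Suc k)
  then have [measurable]: "(\<lambda>\<omega>. ou_path a \<delta> w n x k \<omega>) \<in> borel_measurable P"
    "w (Suc k) \<in> borel_measurable P"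
    by (auto intro: w_measurable)
  show ?case by (cases "Suc k \<le> n") simp_all
next
  case 0
  have "ou_path a \<delta> w n x 0 = (\<lambda>_. x)" by (simp add: fun_eq_iff)
  then show ?case by simp
qed

lemma ou_path_X:
  assumes "\<omega> \<in> space P" "n \<le> k" "k \<le> M"
  shows "ou_path a \<delta> w n (X n \<omega>) k \<omega> = X k \<omega>"
  using assms(2,3)
proof (induction k)
  case (Suc k)
  show ?case
  proof (cases "Suc k \<le> n")
    case True
    then have "n = Suc k" using Suc.prems by simp
    then show ?thesis by simp
  next
    case False
    then show ?thesis using Suc recursion[of "Suc k"] assms(1) by simp
  qed
qed (use assms in auto)

lemma ou_path_noise:
  "k \<le> M \<Longrightarrow> ou_path a \<delta> w n x k \<omega> =
     ou_path a \<delta> (\<lambda>j v. v j) n x k (restrict (\<lambda>j. w j \<omega>) {n<..M})"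
  by (induction k) auto

lemma X_from_past:
  "\<omega> \<in> space P \<Longrightarrow> k \<le> n \<Longrightarrow> n \<le> M \<Longrightarrow> X k \<omega> =
     ou_path a \<delta> (\<lambda>j v. v j) 0 (restrict (\<lambda>j. if j = 0 then X 0 \<omega> else w j \<omega>) {0..n} 0) k
       (restrict (\<lambda>j. if j = 0 then X 0 \<omega> else w j \<omega>) {0..n})"
  by (induction k) (auto simp: recursion)

lemma present_future_indep:
  assumes "n \<le> M"
  shows "distr P borel (X n) \<Otimes>\<^sub>M distr P (\<Pi>\<^sub>M j\<in>{n<..M}. borel) (\<lambda>\<omega>. restrict (\<lambda>j. w j \<omega>) {n<..M}) =
    distr P (borel \<Otimes>\<^sub>M (\<Pi>\<^sub>M j\<in>{n<..M}. borel)) (\<lambda>\<omega>. (X n \<omega>, restrict (\<lambda>j. w j \<omega>) {n<..M}))"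
proof -
  let ?Z = "\<lambda>k \<omega>. if k = 0 then X 0 \<omega> else w k \<omega>"
  let ?g = "\<lambda>v :: nat \<Rightarrow> real. ou_path a \<delta> (\<lambda>j v. v j) 0 (v 0) n v"
  let ?L = "\<Pi>\<^sub>M j\<in>{0..n}. (borel :: real measure)"
  let ?N = "\<Pi>\<^sub>M j\<in>{n<..M}. (borel :: real measure)"
  let ?H = "\<lambda>\<omega>. restrict (\<lambda>k. ?Z k \<omega>) {0..n}"
  let ?W = "\<lambda>\<omega>. restrict (\<lambda>j. w j \<omega>) {n<..M}"
  have "(\<lambda>k. if k = 0 then X 0 else w k) = ?Z" by (auto simp: fun_eq_iff)
  then have Z: "indep_vars (\<lambda>_. borel) ?Z {0..M}" using indep by simp
  have W_eq: "(\<lambda>\<omega>. restrict (\<lambda>k. ?Z k \<omega>) {n<..M}) = ?W"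
    by (auto simp: fun_eq_iff restrict_def)
  have "indep_var ?L ?H ?N ?W"
    unfolding W_eq[symmetric] by (rule indep_var_restrict[OF Z]) (use assms in auto)
  then have H [measurable]: "?H \<in> P \<rightarrow>\<^sub>M ?L" and W [measurable]: "?W \<in> P \<rightarrow>\<^sub>M ?N"
    and joint: "distr P ?L ?H \<Otimes>\<^sub>M distr P ?N ?W = distr P (?L \<Otimes>\<^sub>M ?N) (\<lambda>\<omega>. (?H \<omega>, ?W \<omega>))"
    unfolding indep_var_distribution_eq by blast+
  have g [measurable]: "?g \<in> ?L \<rightarrow>\<^sub>M borel"
  proof -
    have "(\<lambda>v. ou_path a \<delta> (\<lambda>j v. v j) 0 (v 0) k v) \<in> ?L \<rightarrow>\<^sub>M borel"
      if "k \<le> n" for k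
      using that
    proof (induction k)
      case (Suc k)
      then have [measurable]: "Suc k \<in> {0..n}"
        "(\<lambda>v. ou_path a \<delta> (\<lambda>j v. v j) 0 (v 0) k v) \<in> ?L \<rightarrow>\<^sub>M borel"
        by auto
      show ?case by simp
    qed simp
    then show ?thesis by simp
  qed
  have eq: "?g (?H \<omega>) = X n \<omega>" if "\<omega> \<in> space P" for \<omega>
    using X_from_past[OF that order_refl assms] by simp
  interpret R: prob_space "distr P ?N ?W" by (rule prob_space_distr) (rule W)
  have sf: "sigma_finite_measure (distr (distr P ?N ?W) ?N (\<lambda>v. v))"
    by (simp add: distr_id2 R.sigma_finite_measure_axioms)
  have "distr P borel (X n) = distr P borel (\<lambda>\<omega>. ?g (?H \<omega>))"
    by (rule distr_cong) (simp_all only: eq)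
  also have "\<dots> = distr (distr P ?L ?H) borel ?g"
    by (subst distr_distr[OF g H]) (simp add: comp_def)
  finally have "distr P borel (X n) \<Otimes>\<^sub>M distr P ?N ?W =
      distr (distr P ?L ?H) borel ?g \<Otimes>\<^sub>M distr (distr P ?N ?W) ?N (\<lambda>v. v)"
    by (simp add: distr_id2)
  also have "\<dots> = distr (distr P ?L ?H \<Otimes>\<^sub>M distr P ?N ?W) (borel \<Otimes>\<^sub>M ?N) (\<lambda>(x, y). (?g x, y))"
    by (rule pair_measure_distr[OF _ _ sf]) simp_all
  also have "\<dots> = distr P (borel \<Otimes>\<^sub>M ?N) (\<lambda>\<omega>. (?g (?H \<omega>), ?W \<omega>))"
    unfolding joint by (subst distr_distr) (simp_all add: comp_def)
  also have "\<dots> = distr P (borel \<Otimes>\<^sub>M ?N) (\<lambda>\<omega>. (X n \<omega>, ?W \<omega>))"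
    by (rule distr_cong) (simp_all only: eq)
  finally show ?thesis .
qed

theorem expectation_from_version:
  assumes n: "n \<le> M"
    and f: "f \<in> borel_measurable (path_filtration n M)"
    and int: "integrable P (\<lambda>\<omega>. f (\<lambda>k. X k \<omega>))"
  shows "AE \<omega> in P. real_cond_exp P (vimage_algebra (space P) (X n) borel) (\<lambda>\<omega>. f (\<lambda>k. X k \<omega>)) \<omega>
           = expectation_from P a \<delta> w n (X n \<omega>) f"
proof -
  let ?N = "\<Pi>\<^sub>M j\<in>{n<..M}. (borel :: real measure)"
  let ?W = "\<lambda>\<omega>. restrict (\<lambda>j. w j \<omega>) {n<..M}"
  let ?F = "vimage_algebra (space P) (X n) borel"
  define h where "h = (\<lambda>(x, v). f (\<lambda>k. ou_path a \<delta> (\<lambda>j v. v j) n x k v))"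
  define \<mu> where "\<mu> = distr P borel (X n)"
  define \<rho> where "\<rho> = distr P ?N ?W"
  have Xn [measurable]: "X n \<in> borel_measurable P" by (rule X_measurable[OF n])
  have W [measurable]: "?W \<in> P \<rightarrow>\<^sub>M ?N"
    by (rule measurable_restrict) (auto intro: w_measurable)
  interpret mu: prob_space \<mu> unfolding \<mu>_def by (rule prob_space_distr) simp
  interpret rho: prob_space \<rho> unfolding \<rho>_def by (rule prob_space_distr) (rule W)
  interpret pair_sigma_finite \<mu> \<rho> ..
  have sets_mr: "sets \<mu> = sets borel" "sets \<rho> = sets ?N" by (auto simp: \<mu>_def \<rho>_def)
  have joint: "\<mu> \<Otimes>\<^sub>M \<rho> = distr P (borel \<Otimes>\<^sub>M ?N) (\<lambda>\<omega>. (X n \<omega>, ?W \<omega>))"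
    using present_future_indep[OF n] unfolding \<mu>_def \<rho>_def by simp
  have h [measurable]: "h \<in> borel_measurable (borel \<Otimes>\<^sub>M ?N)"
  proof -
    have "(\<lambda>z. \<lambda>k. ou_path a \<delta> (\<lambda>j v. v j) n (fst z) k (snd z)) \<in> borel \<Otimes>\<^sub>M ?N \<rightarrow>\<^sub>M path_filtration n M"
    proof (rule measurable_into_path_filtration)
      fix k assume "k \<in> {n..M}"
      then have "k \<le> M" by simp
      then show "(\<lambda>z. ou_path a \<delta> (\<lambda>j v. v j) n (fst z) k (snd z)) \<in> borel_measurable (borel \<Otimes>\<^sub>M ?N)"
      proof (induction k)
        case (Suc k)
        then have [measurable]: "(\<lambda>z. ou_path a \<delta> (\<lambda>j v. v j) n (fst z) k (snd z)) \<in>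
          borel_measurable (borel \<Otimes>\<^sub>M ?N)" by auto
        show ?case
        proof (cases "Suc k \<le> n")
          case False
          then have [measurable]: "Suc k \<in> {n<..M}" using Suc.prems by auto
          show ?thesis using False by simp
        qed simp
      qed simp
    qed
    from measurable_compose[OF this f] show ?thesis
      by (simp add: h_def case_prod_beta)
  qed
  have path: "f (\<lambda>k. ou_path a \<delta> w n x k \<omega>) = h (x, ?W \<omega>)" for x \<omega>
    unfolding h_def prod.case
    by (rule path_filtration_depends[OF f]) (use ou_path_noise in auto)
  have fX: "f (\<lambda>k. X k \<omega>) = h (X n \<omega>, ?W \<omega>)" if "\<omega> \<in> space P" for \<omega>
  proof -
    have "f (\<lambda>k. X k \<omega>) = f (\<lambda>k. ou_path a \<delta> w n (X n \<omega>) k \<omega>)"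
      by (rule path_filtration_depends[OF f]) (use ou_path_X[OF that] in auto)
    then show ?thesis using path by simp
  qed
  have E: "expectation_from P a \<delta> w n x f = (\<integral>v. h (x, v) \<partial>\<rho>)" for x
    unfolding expectation_from_def path \<rho>_def by (rule integral_distr[symmetric]) measurable
  have int_h: "integrable (\<mu> \<Otimes>\<^sub>M \<rho>) h"
    unfolding joint
    by (subst integrable_distr_eq)
      (simp_all add: int fX[symmetric] cong: Bochner_Integration.integrable_cong)
  have sub: "subalgebra P ?F"
    unfolding subalgebra_def
    by (auto simp: sets_vimage_algebra2 intro: measurable_sets)
  interpret fin: finite_measure_subalgebra P ?F by standard (rule sub)
  have meas_E [measurable]: "(\<lambda>x. \<integral>v. h (x, v) \<partial>\<rho>) \<in> borel_measurable borel"
    by (rule rho.borel_measurable_lebesgue_integral)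
       (simp add: measurable_cong_sets[OF sets_pair_measure_cong[OF refl sets_mr(2)] refl])
  have XnF: "X n \<in> borel_measurable ?F"
    by (rule measurable_vimage_algebra1) simp
  show ?thesis
    unfolding E
  proof (rule fin.real_cond_exp_charact)
    show "integrable P (\<lambda>\<omega>. f (\<lambda>k. X k \<omega>))" by (rule int)
    have "integrable \<mu> (\<lambda>x. \<integral>v. h (x, v) \<partial>\<rho>)" by (rule integrable_fst'[OF int_h])
    then show "integrable P (\<lambda>\<omega>. \<integral>v. h (X n \<omega>, v) \<partial>\<rho>)"
      unfolding \<mu>_def by (subst (asm) integrable_distr_eq) auto
    show "(\<lambda>\<omega>. \<integral>v. h (X n \<omega>, v) \<partial>\<rho>) \<in> borel_measurable ?F"
      using measurable_compose[OF XnF meas_E] .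
  next
    fix A assume "A \<in> sets ?F"
    then obtain B where B [measurable]: "B \<in> sets borel" and A: "A = X n -` B \<inter> space P"
      by (auto simp: sets_vimage_algebra2)
    have "(\<integral>\<omega>\<in>A. f (\<lambda>k. X k \<omega>) \<partial>P) = (\<integral>\<omega>. indicator B (X n \<omega>) * h (X n \<omega>, ?W \<omega>) \<partial>P)"
      unfolding set_lebesgue_integral_def
      by (rule Bochner_Integration.integral_cong) (auto simp: A fX indicator_def)
    also have "\<dots> = (\<integral>z. indicator B (fst z) * h z \<partial>(\<mu> \<Otimes>\<^sub>M \<rho>))"
      unfolding joint by (subst integral_distr) auto
    also have "\<dots> = (\<integral>x. \<integral>v. indicator B x * h (x, v) \<partial>\<rho> \<partial>\<mu>)"
    proof -
      have "integrable (\<mu> \<Otimes>\<^sub>M \<rho>) (\<lambda>z. indicator B (fst z) * h z)"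
      proof (rule Bochner_Integration.integrable_bound[OF int_h])
        show "(\<lambda>z. indicator B (fst z) * h z) \<in> borel_measurable (\<mu> \<Otimes>\<^sub>M \<rho>)"
          unfolding joint by simp
      qed (auto simp: indicator_def)
      from integral_fst'[OF this] show ?thesis by simp
    qed
    also have "\<dots> = (\<integral>x. indicator B x * (\<integral>v. h (x, v) \<partial>\<rho>) \<partial>\<mu>)" by simp
    also have "\<dots> = (\<integral>\<omega>. indicator B (X n \<omega>) * (\<integral>v. h (X n \<omega>, v) \<partial>\<rho>) \<partial>P)"
      unfolding \<mu>_def by (subst integral_distr) auto
    also have "\<dots> = (\<integral>\<omega>\<in>A. (\<integral>v. h (X n \<omega>, v) \<partial>\<rho>) \<partial>P)"
      unfolding set_lebesgue_integral_def
      by (rule Bochner_Integration.integral_cong) (auto simp: A indicator_def)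
    finally show "(\<integral>\<omega>\<in>A. f (\<lambda>k. X k \<omega>) \<partial>P) = (\<integral>\<omega>\<in>A. (\<integral>v. h (X n \<omega>, v) \<partial>\<rho>) \<partial>P)" .
  qed
qed

lemma noise_variance_pos: "0 < (exp (2 * a * \<delta>) - 1) / (2 * a)"
proof (cases "0 < a")
  case True
  then show ?thesis using step_pos by simp
next
  case False
  then have "a < 0" using a_nonzero by simp
  then show ?thesis using step_pos by (simp add: divide_neg_neg mult_neg_pos)
qed

lemma w_square_integrable:
  assumes "1 \<le> k" "k \<le> M"
  shows "integrable P (\<lambda>\<omega>. (w k \<omega>)\<^sup>2)"
proof -
  let ?s = "sqrt ((exp (2 * a * \<delta>) - 1) / (2 * a))"
  have "0 < ?s" using noise_variance_pos by simp
  then have "integrable lborel (\<lambda>x. normal_density 0 ?s x * (x - 0) ^ (2 * 1))"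
    using integrable.intros[OF normal_moment_even[of ?s 0 1]] by blast
  then show ?thesis
    using distributed_integrable[OF noise_normal[OF assms], of "\<lambda>x. x\<^sup>2"] by simp
qed

lemma ou_path_square_integrable: "k \<le> M \<Longrightarrow> integrable P (\<lambda>\<omega>. (ou_path a \<delta> w n x k \<omega>)\<^sup>2)"
proof (induction k)
  case (Suc k)
  let ?c = "exp (a * \<delta>)"
  show ?case
  proof (cases "Suc k \<le> n")
    case False
    have [measurable]: "(\<lambda>\<omega>. ou_path a \<delta> w n x k \<omega>) \<in> borel_measurable P"
      "w (Suc k) \<in> borel_measurable P"
      using Suc.prems by (auto intro: ou_path_measurable w_measurable)
    have "integrable P (\<lambda>\<omega>. 2 * ?c\<^sup>2 * (ou_path a \<delta> w n x k \<omega>)\<^sup>2 + 2 * (w (Suc k) \<omega>)\<^sup>2)"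
      using Suc w_square_integrable[of "Suc k"] by simp
    then have "integrable P (\<lambda>\<omega>. (?c * ou_path a \<delta> w n x k \<omega> + w (Suc k) \<omega>)\<^sup>2)"
    proof (rule Bochner_Integration.integrable_bound)
      have "(p + q)\<^sup>2 \<le> 2 * p\<^sup>2 + 2 * q\<^sup>2" for p q :: real
        using zero_le_power2[of "p - q"] by (simp add: power2_eq_square algebra_simps)
      from this[of "?c * ou_path a \<delta> w n x k \<omega>" "w (Suc k) \<omega>" for \<omega>]
      show "AE \<omega> in P. norm ((?c * ou_path a \<delta> w n x k \<omega> + w (Suc k) \<omega>)\<^sup>2)
          \<le> norm (2 * ?c\<^sup>2 * (ou_path a \<delta> w n x k \<omega>)\<^sup>2 + 2 * (w (Suc k) \<omega>)\<^sup>2)"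
        by (intro AE_I2) (simp add: power_mult_distrib mult.assoc)
    qed measurable
    then show ?thesis using False by simp
  qed simp
qed simp

lemma stopped_reward_le:
  assumes "\<nu> \<in> stopping_times n M"
  shows "\<bar>sampling_reward a \<delta> M (\<nu> y) (y (\<nu> y))\<bar> \<le> (\<Sum>k\<le>M. \<bar>sampling_reward a \<delta> M k (y k)\<bar>)"
  using assms by (intro member_le_sum) (auto simp: stopping_times_def)

lemma reward_bound_integrable:
  "integrable P (\<lambda>\<omega>. \<Sum>k\<le>M. \<bar>sampling_reward a \<delta> M k (ou_path a \<delta> w n x k \<omega>)\<bar>)"
  unfolding sampling_reward_def
  by (intro Bochner_Integration.integrable_sum integrable_abs integrable_mult_left
      ou_path_square_integrable) auto

lemma stopped_reward_integrable:
  assumes \<nu>: "\<nu> \<in> stopping_times n M"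
  shows "integrable P (\<lambda>\<omega>. sampling_reward a \<delta> M (\<nu> (\<lambda>k. ou_path a \<delta> w n x k \<omega>))
           (ou_path a \<delta> w n x (\<nu> (\<lambda>k. ou_path a \<delta> w n x k \<omega>)) \<omega>))"
proof (rule Bochner_Integration.integrable_bound[OF reward_bound_integrable])
  let ?p = "\<lambda>\<omega> k. ou_path a \<delta> w n x k \<omega>"
  have \<nu>_le: "\<nu> y \<le> M" for y using \<nu> by (auto simp: stopping_times_def)
  have p: "?p \<in> P \<rightarrow>\<^sub>M path_filtration n M"
    by (rule measurable_into_path_filtration) (auto intro: ou_path_measurable)
  have le [measurable]: "Measurable.pred P (\<lambda>\<omega>. \<nu> (?p \<omega>) \<le> k)" for k
  proof (cases "k \<le> M")
    case True
    have "Measurable.pred (path_filtration n k) (\<lambda>y. \<nu> y \<le> k)"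
      using \<nu> by (auto simp: stopping_times_def dest: stopping_timeD)
    then have "Measurable.pred (path_filtration n M) (\<lambda>y. \<nu> y \<le> k)"
      using path_filtration_mono[OF True, of n] by (auto simp: pred_def)
    from measurable_compose[OF p this] show ?thesis .
  next
    case False
    then have "\<nu> y \<le> k" for y using \<nu>_le[of y] by linarith
    then show ?thesis by simp
  qed
  have eq: "(\<lambda>\<omega>. \<nu> (?p \<omega>) = k) = (\<lambda>\<omega>. \<nu> (?p \<omega>) \<le> k \<and> \<not> (0 < k \<and> \<nu> (?p \<omega>) \<le> k - 1))" for k
    by (auto simp: fun_eq_iff)
  have [measurable]: "Measurable.pred P (\<lambda>\<omega>. \<nu> (?p \<omega>) = k)" for k
    unfolding eq by measurable
  have "(\<lambda>\<omega>. \<Sum>k\<le>M. if \<nu> (?p \<omega>) = k then sampling_reward a \<delta> M k (?p \<omega> k) else 0) \<in> borel_measurable P"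
    unfolding sampling_reward_def
    by (intro borel_measurable_sum measurable_If borel_measurable_times borel_measurable_power
        borel_measurable_const ou_path_measurable) auto
  moreover have "(\<Sum>k\<le>M. if \<nu> (?p \<omega>) = k then sampling_reward a \<delta> M k (?p \<omega> k) else 0)
      = sampling_reward a \<delta> M (\<nu> (?p \<omega>)) (?p \<omega> (\<nu> (?p \<omega>)))" for \<omega>
    using \<nu>_le by simp
  ultimately show "(\<lambda>\<omega>. sampling_reward a \<delta> M (\<nu> (?p \<omega>)) (?p \<omega> (\<nu> (?p \<omega>)))) \<in> borel_measurable P"
    by simp
  show "AE \<omega> in P. norm (sampling_reward a \<delta> M (\<nu> (?p \<omega>)) (?p \<omega> (\<nu> (?p \<omega>))))
      \<le> norm (\<Sum>k\<le>M. \<bar>sampling_reward a \<delta> M k (?p \<omega> k)\<bar>)"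
    using stopped_reward_le[OF \<nu>] by (auto simp: abs_of_nonneg sum_nonneg)
qed

lemma stopping_values_bdd_above: "bdd_above (stopping_values P a \<delta> M w n x)"
proof (rule bdd_aboveI)
  fix r assume "r \<in> stopping_values P a \<delta> M w n x"
  then obtain \<nu> where \<nu>: "\<nu> \<in> stopping_times n M" and
    r: "r = expectation_from P a \<delta> w n x (\<lambda>y. sampling_reward a \<delta> M (\<nu> y) (y (\<nu> y)))"
    by (auto simp: stopping_values_def)
  show "r \<le> (\<integral>\<omega>. (\<Sum>k\<le>M. \<bar>sampling_reward a \<delta> M k (ou_path a \<delta> w n x k \<omega>)\<bar>) \<partial>P)"
    unfolding r expectation_from_def
    by (rule integral_mono[OF stopped_reward_integrable[OF \<nu>] reward_bound_integrable])
       (rule order_trans[OF abs_ge_self stopped_reward_le[OF \<nu>]])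
qed

lemma stopping_values_nonempty:
  assumes "n \<le> M"
  shows "stopping_values P a \<delta> M w n x \<noteq> {}"
proof -
  have "(\<lambda>_. n) \<in> stopping_times n M"
    using assms by (auto simp: stopping_times_def intro: stopping_time_const)
  then show ?thesis by (auto simp: stopping_values_def)
qed

end

end

theory Submission
  imports Defs
begin

text \<open>Write the value function with \<open>j\<close> steps to go as \<open>q\<^sub>j x\<^sup>2 + h\<^sub>j(x)\<close>, where \<open>q\<^sub>j x\<^sup>2\<close> is the
  reward for stopping at once. Since \<open>q\<^sub>j\<^sub>+\<^sub>1 = e\<^bsup>2a\<delta>\<^esup> q\<^sub>j + \<sigma>\<^sup>2\<close>, with \<open>\<sigma>\<^sup>2\<close> the noise variance, the gain
  of continuing over stopping with \<open>j + 1\<close> steps to go is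
  \<open>\<E>[h\<^sub>j(e\<^bsup>a\<delta>\<^esup> x + W)] + \<sigma>\<^sup>2 (q\<^sub>j - x\<^sup>2)\<close>, and \<open>h\<^sub>j\<^sub>+\<^sub>1\<close> is its positive part. Convolving an even function
  decreasing in \<open>\<bar>x\<bar>\<close> with a centred Gaussian density keeps these properties, so by induction every
  gain is even, continuous and decreasing in \<open>\<bar>x\<bar>\<close>; it is eventually negative, hence changes sign at
  a threshold.

  That this recursion computes the supremum over stopping times follows by telescoping the candidate
  value along the path up to the stopping time: each increment has conditional mean \<open>\<le> 0\<close>, with
  equality for the rule that stops as soon as the gain is nonpositive.\<close>

section \<open>Convolution with a symmetric kernel, and sign changes\<close>

text \<open>Put the origin at the midpoint \<open>s\<close> of \<open>u\<close> and \<open>v\<close>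
  and average with the reflection t -> -t. Twice the difference of the two sides is then the
  integral of (phi(t+d) - phi(t-d)) (h(s+t) - h(s-t)), and its two factors never have opposite
  signs.\<close>

lemma symmetric_decreasing_convolution_antimono:
  fixes \<phi> h :: "real \<Rightarrow> real"
  assumes \<phi>: "integrable lborel \<phi>"
    and \<phi>_dec: "\<And>x y. \<bar>x\<bar> \<le> \<bar>y\<bar> \<Longrightarrow> \<phi> y \<le> \<phi> x"
    and h [measurable]: "h \<in> borel_measurable borel"
    and h_dec: "\<And>x y. \<bar>x\<bar> \<le> \<bar>y\<bar> \<Longrightarrow> h y \<le> h x"
    and h_bound: "\<And>x. \<bar>h x\<bar> \<le> B"
    and uv: "\<bar>u\<bar> \<le> \<bar>v\<bar>"
  shows "(\<integral>z. \<phi> z * h (v + z) \<partial>lborel) \<le> (\<integral>z. \<phi> z * h (u + z) \<partial>lborel)"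
proof -
  define s d where "s = (u + v) / 2" and "d = (v - u) / 2"
  have u: "u = s - d" and v: "v = s + d" by (simp_all add: s_def d_def field_simps)
  have \<phi>_meas [measurable]: "\<phi> \<in> borel_measurable borel" using \<phi> by auto
  have even: "\<phi> (- x) = \<phi> x" for x by (intro antisym \<phi>_dec) auto
  have \<phi>_shift: "integrable lborel (\<lambda>t. \<phi> (t + r))" for r
    using lborel_integrable_real_affine[OF \<phi>, of 1 r] by (simp add: add.commute)
  \<comment> \<open>The parameter \<open>e\<close> is 1 or -1 below; the unsimplified
    \<open>1 * t\<close> and \<open>(-1) * t\<close> keep all four integrals instances of this one
    pattern.\<close>
  have int: "integrable lborel (\<lambda>t. \<phi> (t + r) * h (s + e * t))" for r e
  proof (rule Bochner_Integration.integrable_bound)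
    show "integrable lborel (\<lambda>t. \<phi> (t + r) * B)" using \<phi>_shift by simp
    show "AE t in lborel. norm (\<phi> (t + r) * h (s + e * t)) \<le> norm (\<phi> (t + r) * B)"
      using h_bound by (auto simp: abs_mult intro!: mult_left_mono order_trans[OF h_bound abs_ge_self])
  qed measurable
  have shift: "(\<integral>z. \<phi> z * h (p + z) \<partial>lborel) = (\<integral>t. \<phi> (t + (s - p)) * h (s + 1 * t) \<partial>lborel)" for p
    by (subst lborel_integral_real_affine[of 1 _ "s - p"]) (simp_all add: algebra_simps)
  have reflect: "(\<integral>t. \<phi> (t + r) * h (s + 1 * t) \<partial>lborel) = (\<integral>t. \<phi> (t + - r) * h (s + (-1) * t) \<partial>lborel)" for r
  proof -
    have "\<phi> (r - t) = \<phi> (t + - r)" for t using even[of "t + - r"] by simp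
    then show ?thesis
      by (subst lborel_integral_real_affine[of "-1" _ 0]) (simp_all add: algebra_simps)
  qed
  \<comment> \<open>The hypothesis on \<open>u\<close> and \<open>v\<close> in the new coordinates,
    since v^2 - u^2 = 4sd.\<close>
  have sd: "0 \<le> s * d"
    using abs_le_square_iff[of u v] uv by (simp add: u v power2_eq_square algebra_simps)
  have pos: "0 \<le> (\<phi> (t + d) - \<phi> (t - d)) * (h (s + 1 * t) - h (s + (-1) * t))" for t
  proof -
    \<comment> \<open>The first comparison in each pair depends on the sign of td, the second on
      that of ts; as \<open>s\<close> and \<open>d\<close> do not have opposite signs, the two
      comparisons go the same way.\<close>
    have "\<bar>t + d\<bar> \<le> \<bar>t - d\<bar> \<and> \<bar>s + t\<bar> \<le> \<bar>s - t\<bar> \<or> \<bar>t - d\<bar> \<le> \<bar>t + d\<bar> \<and> \<bar>s - t\<bar> \<le> \<bar>s + t\<bar>"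
      using sd unfolding zero_le_mult_iff by linarith
    then show ?thesis
    proof
      assume "\<bar>t + d\<bar> \<le> \<bar>t - d\<bar> \<and> \<bar>s + t\<bar> \<le> \<bar>s - t\<bar>"
      then show ?thesis
        using \<phi>_dec[of "t + d" "t - d"] h_dec[of "s + t" "s - t"]
        by (intro mult_nonneg_nonneg) auto
    next
      assume "\<bar>t - d\<bar> \<le> \<bar>t + d\<bar> \<and> \<bar>s - t\<bar> \<le> \<bar>s + t\<bar>"
      then show ?thesis
        using \<phi>_dec[of "t - d" "t + d"] h_dec[of "s - t" "s + t"]
        by (intro mult_nonpos_nonpos) auto
    qed
  qed
  let ?I = "\<lambda>r e. \<integral>t. \<phi> (t + r) * h (s + e * t) \<partial>lborel"
  have "0 \<le> (\<integral>t. (\<phi> (t + d) - \<phi> (t - d)) * (h (s + 1 * t) - h (s + (-1) * t)) \<partial>lborel)"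
    using pos by (rule Bochner_Integration.integral_nonneg)
  also have "\<dots> = (\<integral>t. (\<phi> (t + d) * h (s + 1 * t) - \<phi> (t + - d) * h (s + 1 * t))
      - (\<phi> (t + d) * h (s + (-1) * t) - \<phi> (t + - d) * h (s + (-1) * t)) \<partial>lborel)"
    by (rule Bochner_Integration.integral_cong) (simp_all add: algebra_simps)
  also have "\<dots> = (?I d 1 - ?I (- d) 1) - (?I d (-1) - ?I (- d) (-1))"
    by (simp only: Bochner_Integration.integral_diff Bochner_Integration.integrable_diff int)
  also have "?I d (-1) = ?I (- d) 1" using reflect[of "- d"] by (simp only: minus_minus)
  also have "?I (- d) (-1) = ?I d 1" using reflect[of d] by simp
  finally have "?I (- d) 1 \<le> ?I d 1" by simp
  then show ?thesis
    unfolding shift[of u] shift[of v] by (simp add: u v)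
qed

text \<open>Dominated convergence along a sequence, with |phi| B as the majorant.\<close>

lemma continuous_on_convolution:
  fixes \<phi> h :: "real \<Rightarrow> real"
  assumes \<phi>: "integrable lborel \<phi>"
    and h: "continuous_on UNIV h"
    and h_bound: "\<And>x. \<bar>h x\<bar> \<le> B"
  shows "continuous_on UNIV (\<lambda>x. \<integral>z. \<phi> z * h (x + z) \<partial>lborel)"
  unfolding continuous_on_sequentially
proof (intro allI ballI impI, elim conjE)
  fix x :: "nat \<Rightarrow> real" and l assume x: "x \<longlonglongrightarrow> l"
  have [measurable]: "h \<in> borel_measurable borel" "\<phi> \<in> borel_measurable borel"
    using h \<phi> by (auto intro: borel_measurable_continuous_onI)
  have "(\<lambda>i. \<integral>z. \<phi> z * h (x i + z) \<partial>lborel) \<longlonglongrightarrow> (\<integral>z. \<phi> z * h (l + z) \<partial>lborel)"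
  proof (rule integral_dominated_convergence)
    show "integrable lborel (\<lambda>z. \<bar>\<phi> z\<bar> * B)" using \<phi> by simp
    have "(\<lambda>i. h (x i + z)) \<longlonglongrightarrow> h (l + z)" for z
      using continuous_on_tendsto_compose[OF h, of "\<lambda>i. x i + z" "l + z" sequentially]
        tendsto_add[OF x tendsto_const] by auto
    then show "AE z in lborel. (\<lambda>i. \<phi> z * h (x i + z)) \<longlonglongrightarrow> \<phi> z * h (l + z)"
      by (intro AE_I2 tendsto_intros)
    show "AE z in lborel. norm (\<phi> z * h (x i + z)) \<le> \<bar>\<phi> z\<bar> * B" for i
      using h_bound by (auto simp: abs_mult intro!: mult_left_mono)
  qed measurable
  then show "((\<lambda>x. \<integral>z. \<phi> z * h (x + z) \<partial>lborel) \<circ> x) \<longlonglongrightarrow> (\<integral>z. \<phi> z * h (l + z) \<partial>lborel)"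
    by (simp add: comp_def)
qed

text \<open>If \<open>D 0\<close> is positive, the intermediate value theorem gives a zero of
  \<open>D\<close>, and monotonicity in the absolute value fixes the sign on either side of it.
  Otherwise \<open>D\<close> is nonpositive everywhere and 0 serves.\<close>

lemma threshold_exists:
  fixes D :: "real \<Rightarrow> real"
  assumes cont: "continuous_on UNIV D"
    and dec: "\<And>x y. \<bar>x\<bar> \<le> \<bar>y\<bar> \<Longrightarrow> D y \<le> D x"
    and neg: "D b \<le> 0"
  obtains t where "0 \<le> t" "\<And>x. t \<le> \<bar>x\<bar> \<Longrightarrow> D x \<le> 0" "\<And>x. \<bar>x\<bar> < t \<Longrightarrow> 0 \<le> D x"
proof (cases "D 0 \<le> 0")
  case True
  have "D x \<le> 0" for x using dec[of 0 x] True by simp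
  then show ?thesis using that[of 0] by auto
next
  case False
  have "D \<bar>b\<bar> \<le> 0" using dec[of b "\<bar>b\<bar>"] neg by simp
  then obtain t where t: "0 \<le> t" "D t = 0"
    using IVT2'[of D "\<bar>b\<bar>" 0 0] False continuous_on_subset[OF cont] by auto
  show ?thesis
  proof
    show "D x \<le> 0" if "t \<le> \<bar>x\<bar>" for x using dec[of t x] that t by simp
    show "0 \<le> D x" if "\<bar>x\<bar> < t" for x using dec[of x t] that t by simp
  qed (rule t)
qed

lemma normal_density_antimono:
  assumes "\<bar>x\<bar> \<le> \<bar>y\<bar>"
  shows "normal_density 0 s y \<le> normal_density 0 s x"
proof -
  have "x\<^sup>2 \<le> y\<^sup>2" using assms by (simp add: abs_le_square_iff)
  then have "- (y\<^sup>2 / (2 * s\<^sup>2)) \<le> - (x\<^sup>2 / (2 * s\<^sup>2))"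
    by (simp add: divide_right_mono)
  then show ?thesis
    unfolding normal_density_def by (intro mult_left_mono) auto
qed

section \<open>Telescoping up to a random time, and integrating out independent noise\<close>

text \<open>The cut-off sits in a factor 0 or 1, so the range of summation stays deterministic when
  \<open>m\<close> is the value of a stopping time, and the sum can be exchanged with the
  expectation.\<close>

lemma telescope_until:
  fixes u :: "nat \<Rightarrow> real"
  assumes "n \<le> m" "m \<le> N"
  shows "u m = u n + (\<Sum>k = n..<N. of_bool (k < m) * (u (Suc k) - u k))"
proof -
  have "(\<Sum>k = n..<N. of_bool (k < m) * (u (Suc k) - u k)) = (\<Sum>k = n..<m. u (Suc k) - u k)"
    using assms by (intro sum.mono_neutral_cong_right) auto
  then show ?thesis using sum_Suc_diff'[OF assms(1), of u] by simp
qed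

lemma path_filtration_component:
  assumes "k \<in> {n..t}"
  shows "(\<lambda>y. y k) \<in> borel_measurable (path_filtration n t)"
proof -
  have "(\<lambda>y. restrict y {n..t}) \<in> path_filtration n t \<rightarrow>\<^sub>M (\<Pi>\<^sub>M j\<in>{n..t}. (borel :: real measure))"
    unfolding path_filtration_def by (rule measurable_vimage_algebra1) (auto simp: space_PiM)
  then have "(\<lambda>y. restrict y {n..t} k) \<in> borel_measurable (path_filtration n t)"
    using assms by (rule measurable_component_singleton[THEN measurable_compose_rev, rotated])
  then show ?thesis using assms by simp
qed

text \<open>By independence the joint law is a product, so Fubini applies. The inner expectation
  freezes \<open>Y\<close> and averages over \<open>Z\<close> alone.\<close>

lemma (in prob_space) expectation_indep_fubini:
  fixes F :: "'b \<times> 'b \<Rightarrow> real"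
  assumes ind: "indep_var S Y T Z"
    and F: "F \<in> borel_measurable (S \<Otimes>\<^sub>M T)"
    and int: "integrable M (\<lambda>\<omega>. F (Y \<omega>, Z \<omega>))"
  shows "expectation (\<lambda>\<omega>. F (Y \<omega>, Z \<omega>)) = expectation (\<lambda>\<omega>. expectation (\<lambda>\<omega>'. F (Y \<omega>, Z \<omega>')))"
proof -
  from ind have Y [measurable]: "Y \<in> M \<rightarrow>\<^sub>M S" and Z [measurable]: "Z \<in> M \<rightarrow>\<^sub>M T"
    and joint: "distr M S Y \<Otimes>\<^sub>M distr M T Z = distr M (S \<Otimes>\<^sub>M T) (\<lambda>\<omega>. (Y \<omega>, Z \<omega>))"
    unfolding indep_var_distribution_eq by blast+
  interpret Y: prob_space "distr M S Y" by (rule prob_space_distr) (rule Y)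
  interpret Z: prob_space "distr M T Z" by (rule prob_space_distr) (rule Z)
  interpret pair_sigma_finite "distr M S Y" "distr M T Z" ..
  have inner: "(\<integral>z. F (y, z) \<partial>distr M T Z) = expectation (\<lambda>\<omega>'. F (y, Z \<omega>'))" if "y \<in> space S" for y
    using that F by (intro integral_distr) (auto intro: measurable_compose[OF measurable_Pair1'])
  have F': "F \<in> borel_measurable (distr M S Y \<Otimes>\<^sub>M distr M T Z)" using F by (simp add: joint)
  have outer: "(\<lambda>y. \<integral>z. F (y, z) \<partial>distr M T Z) \<in> borel_measurable S"
    using Z.borel_measurable_lebesgue_integral[of "\<lambda>y z. F (y, z)" "distr M S Y"] F'
    by simp
  have "expectation (\<lambda>\<omega>. F (Y \<omega>, Z \<omega>)) = (\<integral>p. F p \<partial>(distr M S Y \<Otimes>\<^sub>M distr M T Z))"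
    unfolding joint using F by (subst integral_distr) auto
  also have "\<dots> = (\<integral>y. \<integral>z. F (y, z) \<partial>distr M T Z \<partial>distr M S Y)"
    by (rule integral_fst'[symmetric]) (use F int in \<open>simp add: joint integrable_distr_eq\<close>)
  also have "\<dots> = expectation (\<lambda>\<omega>. \<integral>z. F (Y \<omega>, z) \<partial>distr M T Z)"
    using outer by (subst integral_distr) auto
  also have "\<dots> = expectation (\<lambda>\<omega>. expectation (\<lambda>\<omega>'. F (Y \<omega>, Z \<omega>')))"
    using measurable_space[OF Y] by (intro Bochner_Integration.integral_cong) (auto simp: inner)
  finally show ?thesis .
qed

section \<open>Weights and the one-step transition operator\<close>

context ou_chain
begin

definition noise_var :: real where
  "noise_var = (exp (2 * a * \<delta>) - 1) / (2 * a)"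

text \<open>Indexed by steps to go instead of time: the coefficient of x^2 in the reward, as in
  \<open>sampling_reward_eq\<close>.\<close>

definition weight :: "nat \<Rightarrow> real" where
  "weight j = (exp (2 * a * \<delta> * real j) - 1) / (2 * a)"

text \<open>Written as an integral against the noise density, so that the convolution lemmas apply
  and the time index disappears.\<close>

definition transition :: "(real \<Rightarrow> real) \<Rightarrow> real \<Rightarrow> real" where
  "transition f x = (\<integral>z. normal_density 0 (sqrt noise_var) z * f (exp (a * \<delta>) * x + z) \<partial>lborel)"

lemma noise_var_pos: "0 < noise_var"
  using noise_variance_pos by (simp add: noise_var_def)

lemma weight_0 [simp]: "weight 0 = 0"
  by (simp add: weight_def)

text \<open>With r = e^(2a\<delta>), this is r^(j+1) - 1 = r (r^j - 1) + (r - 1), divided by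
  2a.\<close>

lemma weight_Suc: "weight (Suc j) = (exp (a * \<delta>))\<^sup>2 * weight j + noise_var"
proof -
  have "exp (2 * a * \<delta> * real (Suc j)) = (exp (a * \<delta>))\<^sup>2 * exp (2 * a * \<delta> * real j)"
    by (simp add: exp_double[symmetric] mult_exp_exp algebra_simps)
  moreover have "exp (2 * a * \<delta>) = (exp (a * \<delta>))\<^sup>2"
    by (simp add: exp_double[symmetric] algebra_simps)
  ultimately show ?thesis
    unfolding weight_def noise_var_def by (simp add: add_divide_distrib[symmetric] algebra_simps)
qed

lemma weight_nonneg: "0 \<le> weight j"
  using noise_var_pos by (induction j) (simp_all add: weight_Suc)

lemma sampling_reward_eq: "k \<le> M \<Longrightarrow> sampling_reward a \<delta> M k x = weight (M - k) * x\<^sup>2"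
  by (simp add: sampling_reward_def weight_def of_nat_diff)

lemma noise_expectation:
  assumes "k < M" "f \<in> borel_measurable borel"
  shows "expectation (\<lambda>\<omega>. f (exp (a * \<delta>) * x + w (Suc k) \<omega>)) = transition f x"
proof -
  have [measurable]: "f \<in> borel_measurable borel" by fact
  show ?thesis
    unfolding transition_def noise_var_def
    by (rule distributed_integral[OF noise_normal, symmetric]) (use assms(1) in auto)
qed

lemma noise_density_integrable: "integrable lborel (normal_density 0 (sqrt noise_var))"
  using noise_var_pos by simp

text \<open>The centred Gaussian density is a symmetric decreasing kernel, and scaling both
  arguments by e^(a\<delta>) preserves the order of their absolute values.\<close>

lemma transition_antimono:
  assumes "h \<in> borel_measurable borel" "\<And>x y. \<bar>x\<bar> \<le> \<bar>y\<bar> \<Longrightarrow> h y \<le> h x" "\<And>x. \<bar>h x\<bar> \<le> B"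
    and "\<bar>x\<bar> \<le> \<bar>y\<bar>"
  shows "transition h y \<le> transition h x"
  unfolding transition_def
  by (rule symmetric_decreasing_convolution_antimono[OF noise_density_integrable])
    (use assms in \<open>auto intro: normal_density_antimono simp: abs_mult\<close>)

lemma transition_continuous:
  assumes "continuous_on UNIV h" "\<And>x. \<bar>h x\<bar> \<le> B"
  shows "continuous_on UNIV (transition h)"
  unfolding transition_def
  by (rule continuous_on_compose2[OF continuous_on_convolution[OF noise_density_integrable assms]])
    (auto intro!: continuous_intros)

lemma transition_nonneg: "(\<And>x. 0 \<le> h x) \<Longrightarrow> 0 \<le> transition h x"
  unfolding transition_def by (rule Bochner_Integration.integral_nonneg) simp

section \<open>The excess over immediate stopping and the gain of continuing\<close>

primrec excess :: "nat \<Rightarrow> real \<Rightarrow> real" where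
  "excess 0 = (\<lambda>x. 0)"
| "excess (Suc j) = (\<lambda>x. max 0 (transition (excess j) x + noise_var * (weight j - x\<^sup>2)))"

text \<open>Mind the shift: \<open>gap j\<close> is the gain of continuing with j + 1 steps to
  go.\<close>

definition gap :: "nat \<Rightarrow> real \<Rightarrow> real" where
  "gap j x = transition (excess j) x + noise_var * (weight j - x\<^sup>2)"

text \<open>The candidate value with \<open>j\<close> steps to go, split into a bounded part and an
  explicit quadratic; \<open>value_fun_eq\<close> identifies it with the supremum.\<close>

definition optimal_value :: "nat \<Rightarrow> real \<Rightarrow> real" where
  "optimal_value j x = excess j x + weight j * x\<^sup>2"

lemma excess_Suc: "excess (Suc j) x = max 0 (gap j x)"
  by (simp add: gap_def)

declare excess.simps(2) [simp del]

lemma excess_nonneg: "0 \<le> excess j x"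
  by (cases j) (simp_all add: excess_Suc)

text \<open>Being nonnegative and largest at 0, \<open>excess j\<close> is bounded, so its
  transition inherits both properties; the remaining term is a constant minus a positive multiple of
  x^2.\<close>

lemma gap_regular:
  assumes "continuous_on UNIV (excess j)"
    and dec: "\<And>x y. \<bar>x\<bar> \<le> \<bar>y\<bar> \<Longrightarrow> excess j y \<le> excess j x"
  shows "continuous_on UNIV (gap j)" "\<bar>x\<bar> \<le> \<bar>y\<bar> \<Longrightarrow> gap j y \<le> gap j x"
proof -
  have bound: "\<bar>excess j x\<bar> \<le> excess j 0" for x
    using dec[of 0 x] excess_nonneg by simp
  show "continuous_on UNIV (gap j)"
    unfolding gap_def by (intro continuous_intros transition_continuous[OF assms(1) bound])
  show "gap j y \<le> gap j x" if "\<bar>x\<bar> \<le> \<bar>y\<bar>"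
    unfolding gap_def
  proof (intro add_mono mult_left_mono diff_left_mono)
    show "transition (excess j) y \<le> transition (excess j) x"
      using assms(1) by (intro transition_antimono[OF _ dec bound that])
        (auto intro: borel_measurable_continuous_onI)
    show "x\<^sup>2 \<le> y\<^sup>2" using that by (simp add: abs_le_square_iff)
  qed (use noise_var_pos in simp)
qed

text \<open>Continuity and monotonicity go through the induction together because
  \<open>gap_regular\<close> uses both; taking the positive part preserves them.\<close>

lemma excess_regular:
  "continuous_on UNIV (excess j) \<and> (\<forall>x y. \<bar>x\<bar> \<le> \<bar>y\<bar> \<longrightarrow> excess j y \<le> excess j x)"
proof (induction j)
  case (Suc j)
  then have "continuous_on UNIV (gap j)" "\<And>x y. \<bar>x\<bar> \<le> \<bar>y\<bar> \<Longrightarrow> gap j y \<le> gap j x"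
    using gap_regular[of j] by blast+
  then show ?case
    unfolding excess_Suc[abs_def] by (auto intro!: continuous_intros intro: max.coboundedI2)
qed simp

lemma excess_continuous: "continuous_on UNIV (excess j)"
  and excess_antimono: "\<bar>x\<bar> \<le> \<bar>y\<bar> \<Longrightarrow> excess j y \<le> excess j x"
  using excess_regular by blast+

lemmas gap_continuous = gap_regular(1)[OF excess_continuous excess_antimono]
  and gap_antimono = gap_regular(2)[OF excess_continuous excess_antimono]

lemma excess_bound: "\<bar>excess j x\<bar> \<le> excess j 0"
  using excess_antimono[of 0 x] excess_nonneg by simp

lemma excess_measurable [measurable]: "excess j \<in> borel_measurable borel"
  by (intro borel_measurable_continuous_onI excess_continuous)

lemma optimal_value_measurable [measurable]: "optimal_value j \<in> borel_measurable borel"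
  unfolding optimal_value_def by measurable

lemma gap_eventually_nonpos: "\<exists>b. gap j b \<le> 0"
proof
  \<comment> \<open>\<open>T\<close> is the value of x^2 at which the quadratic term cancels the
    upper bound \<open>transition (excess j) 0\<close>.\<close>
  define T where "T = transition (excess j) 0 / noise_var + weight j"
  have T: "0 \<le> T"
    using noise_var_pos weight_nonneg transition_nonneg[OF excess_nonneg] by (simp add: T_def)
  have "gap j (sqrt T) \<le> transition (excess j) 0 + noise_var * (weight j - T)"
    unfolding gap_def
    using transition_antimono[OF excess_measurable excess_antimono excess_bound, of 0 "sqrt T" j] T
    by simp
  also have "\<dots> = 0" using noise_var_pos by (simp add: T_def field_simps)
  finally show "gap j (sqrt T) \<le> 0" .
qed

text \<open>The noise has mean 0 and variance \<open>noise_var\<close>, so the quadratic part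
  contributes q (c^2 x^2 + \<open>noise_var\<close>) with q = \<open>weight j\<close> and c =
  e^(a\<delta>). By \<open>weight_Suc\<close> this is \<open>weight (Suc j)\<close> x^2 +
  \<open>noise_var\<close> (q - x^2).\<close>

lemma transition_optimal_value:
  "transition (optimal_value j) x = gap j x + weight (Suc j) * x\<^sup>2"
proof -
  let ?c = "exp (a * \<delta>)" and ?s = "sqrt noise_var"
  let ?\<phi> = "normal_density 0 ?s"
  have s: "0 < ?s" using noise_var_pos by simp
  have mean: "has_bochner_integral lborel (\<lambda>z. ?\<phi> z * z) 0"
    using normal_moment_odd[OF s, of 0 0] by simp
  have var: "has_bochner_integral lborel (\<lambda>z. ?\<phi> z * z\<^sup>2) noise_var"
    using normal_moment_even[OF s, of 0 1] noise_var_pos by (simp add: fact_numeral)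
  have one: "has_bochner_integral lborel ?\<phi> 1"
    using s noise_density_integrable by (auto simp: has_bochner_integral_iff)
  have ex: "has_bochner_integral lborel (\<lambda>z. ?\<phi> z * excess j (?c * x + z)) (transition (excess j) x)"
    unfolding has_bochner_integral_iff
  proof
    show "integrable lborel (\<lambda>z. ?\<phi> z * excess j (?c * x + z))"
    proof (rule Bochner_Integration.integrable_bound)
      show "integrable lborel (\<lambda>z. ?\<phi> z * excess j 0)" using noise_density_integrable by simp
      show "AE z in lborel. norm (?\<phi> z * excess j (?c * x + z)) \<le> norm (?\<phi> z * excess j 0)"
        using excess_bound excess_nonneg[of j 0] by (auto simp: abs_mult intro!: mult_left_mono)
    qed measurable
  qed (simp add: transition_def)
  \<comment> \<open>The square is expanded, so that each summand is one of the four known integrals;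
    the first moment kills the cross term.\<close>
  have "has_bochner_integral lborel
      (\<lambda>z. ?\<phi> z * excess j (?c * x + z)
        + (?\<phi> z * (weight j * ?c\<^sup>2 * x\<^sup>2) + (?\<phi> z * z * (2 * weight j * ?c * x) + ?\<phi> z * z\<^sup>2 * weight j)))
      (transition (excess j) x
        + (1 * (weight j * ?c\<^sup>2 * x\<^sup>2) + (0 * (2 * weight j * ?c * x) + noise_var * weight j)))"
    by (intro has_bochner_integral_add has_bochner_integral_mult_left ex mean var one)
  moreover have "(\<lambda>z. ?\<phi> z * excess j (?c * x + z)
        + (?\<phi> z * (weight j * ?c\<^sup>2 * x\<^sup>2) + (?\<phi> z * z * (2 * weight j * ?c * x) + ?\<phi> z * z\<^sup>2 * weight j)))
      = (\<lambda>z. ?\<phi> z * optimal_value j (?c * x + z))"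
    by (rule ext) (simp add: optimal_value_def power2_eq_square algebra_simps)
  ultimately show ?thesis
    unfolding transition_def[of "optimal_value j"]
    by (auto dest!: has_bochner_integral_integral_eq
        simp: gap_def weight_Suc algebra_simps)
qed

text \<open>The dynamic programming recursion: add the quadratic to both arguments of
  \<open>max 0 (gap j x)\<close>.\<close>

lemma optimal_value_Suc:
  "optimal_value (Suc j) x = max (weight (Suc j) * x\<^sup>2) (transition (optimal_value j) x)"
  unfolding transition_optimal_value by (simp add: optimal_value_def excess_Suc)

lemma reward_le_optimal_value: "weight j * x\<^sup>2 \<le> optimal_value j x"
  by (simp add: optimal_value_def excess_nonneg)

section \<open>Expectations along the restarted path\<close>

lemma optimal_value_integrable:
  assumes "k \<le> M"
  shows "integrable P (\<lambda>\<omega>. optimal_value j (ou_path a \<delta> w n x k \<omega>))"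
proof -
  have [measurable]: "(\<lambda>\<omega>. ou_path a \<delta> w n x k \<omega>) \<in> borel_measurable P"
    by (rule ou_path_measurable) (rule assms)
  have "integrable P (\<lambda>\<omega>. excess j (ou_path a \<delta> w n x k \<omega>))"
    by (rule integrable_const_bound[where B = "excess j 0"]) (auto simp: excess_bound)
  then show ?thesis
    unfolding optimal_value_def
    by (intro Bochner_Integration.integrable_add integrable_mult_right ou_path_square_integrable assms)
qed

lemma transition_optimal_value_integrable:
  assumes "k \<le> M"
  shows "integrable P (\<lambda>\<omega>. transition (optimal_value j) (ou_path a \<delta> w n x k \<omega>))"
proof -
  have [measurable]: "(\<lambda>\<omega>. ou_path a \<delta> w n x k \<omega>) \<in> borel_measurable P"
    by (rule ou_path_measurable) (rule assms)
  have [measurable]: "transition (excess j) \<in> borel_measurable borel"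
    by (intro borel_measurable_continuous_onI transition_continuous[OF excess_continuous excess_bound])
  have "\<bar>transition (excess j) z\<bar> \<le> transition (excess j) 0" for z
    using transition_antimono[OF excess_measurable excess_antimono excess_bound, of 0 z]
      transition_nonneg[OF excess_nonneg] by simp
  then have "integrable P (\<lambda>\<omega>. transition (excess j) (ou_path a \<delta> w n x k \<omega>))"
    by (intro integrable_const_bound[where B = "transition (excess j) 0"]) auto
  then show ?thesis
    unfolding transition_optimal_value gap_def
    by (intro Bochner_Integration.integrable_add Bochner_Integration.integrable_diff
        integrable_mult_right integrable_const ou_path_square_integrable assms)
qed

text \<open>The Markov property tested against functions of the past. The path up to
  \<open>k\<close> is determined by noise up to \<open>k\<close>, which is independent of the next
  noise term, so the latter can be integrated out first.\<close>

lemma one_step_expectation: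
  assumes nk: "n \<le> k" and kM: "k < M"
    and f: "f \<in> borel_measurable (path_filtration n k)"
    and G [measurable]: "G \<in> borel_measurable borel"
    and int: "integrable P (\<lambda>\<omega>. f (\<lambda>j. ou_path a \<delta> w n x j \<omega>) * G (ou_path a \<delta> w n x (Suc k) \<omega>))"
  shows "expectation (\<lambda>\<omega>. f (\<lambda>j. ou_path a \<delta> w n x j \<omega>) * G (ou_path a \<delta> w n x (Suc k) \<omega>)) =
    expectation (\<lambda>\<omega>. f (\<lambda>j. ou_path a \<delta> w n x j \<omega>) * transition G (ou_path a \<delta> w n x k \<omega>))"
proof -
  let ?c = "exp (a * \<delta>)"
  \<comment> \<open>Index 0 carries \<open>X 0\<close> because joint independence is assumed for the
    family that contains it.\<close>
  let ?V = "\<lambda>j \<omega>. if j = 0 then X 0 \<omega> else w j \<omega>"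
  let ?S = "\<Pi>\<^sub>M j\<in>{0..k}. (borel :: real measure)"
  let ?T = "\<Pi>\<^sub>M j\<in>{Suc k}. (borel :: real measure)"
  let ?Y = "\<lambda>\<omega>. restrict (\<lambda>j. ?V j \<omega>) {0..k}"
  let ?Z = "\<lambda>\<omega>. restrict (\<lambda>j. ?V j \<omega>) {Suc k}"
  let ?path = "\<lambda>\<omega> j. ou_path a \<delta> w n x j \<omega>"
  define p where "p v j = ou_path a \<delta> (\<lambda>j v. v j) n x j v" for v :: "nat \<Rightarrow> real" and j
  define F where "F = (\<lambda>(v, u). f (p v) * G (?c * p v k + u (Suc k)))"
  have "(\<lambda>j. if j = 0 then X 0 else w j) = ?V" by (auto simp: fun_eq_iff)
  then have "indep_vars (\<lambda>_. borel) ?V {0..M}" using indep by simp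
  then have ind: "indep_var ?S ?Y ?T ?Z"
    using kM by (intro indep_var_restrict) auto
  have p_meas: "(\<lambda>v. p v j) \<in> borel_measurable ?S" if "j \<le> k" for j
    using that
  proof (induction j)
    case (Suc j)
    then have [measurable]: "Suc j \<in> {0..k}" "(\<lambda>v. p v j) \<in> borel_measurable ?S" by auto
    have "(\<lambda>v. if Suc j \<le> n then x else ?c * p v j + v (Suc j)) \<in> borel_measurable ?S" by measurable
    then show ?case by (simp only: p_def ou_path.simps)
  qed (simp add: p_def)
  have "p \<in> ?S \<rightarrow>\<^sub>M path_filtration n k"
    by (rule measurable_into_path_filtration) (simp add: p_meas)
  then have [measurable]: "(\<lambda>v. f (p v)) \<in> borel_measurable ?S"
    using f by (rule measurable_compose)
  have [measurable]: "(\<lambda>v. p v k) \<in> borel_measurable ?S" by (rule p_meas) simp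
  have F: "F \<in> borel_measurable (?S \<Otimes>\<^sub>M ?T)" unfolding F_def by measurable
  have path: "?path \<omega> j = p (?Y \<omega>) j" if "j \<le> k" for \<omega> j
    using that by (induction j) (simp_all add: p_def)
  \<comment> \<open>After time \<open>k\<close> the path rebuilt from the truncated noise need not
    agree with the true one, but \<open>f\<close> depends only on the times from \<open>n\<close> to
    \<open>k\<close>.\<close>
  have f_path: "f (?path \<omega>) = f (p (?Y \<omega>))" for \<omega>
    by (rule path_filtration_depends[OF f]) (simp add: path)
  have F_path: "F (?Y \<omega>, ?Z \<omega>') = f (?path \<omega>) * G (?c * ?path \<omega> k + w (Suc k) \<omega>')" for \<omega> \<omega>'
    unfolding F_def f_path by (simp add: path)
  have step: "?path \<omega> (Suc k) = ?c * ?path \<omega> k + w (Suc k) \<omega>" for \<omega>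
    using nk by simp
  have "expectation (\<lambda>\<omega>. f (?path \<omega>) * G (?path \<omega> (Suc k))) = expectation (\<lambda>\<omega>. F (?Y \<omega>, ?Z \<omega>))"
    unfolding F_path step ..
  also have "\<dots> = expectation (\<lambda>\<omega>. expectation (\<lambda>\<omega>'. F (?Y \<omega>, ?Z \<omega>')))"
    by (rule expectation_indep_fubini[OF ind F]) (use int in \<open>simp only: F_path step\<close>)
  also have "\<dots> = expectation (\<lambda>\<omega>. f (?path \<omega>) * transition G (?path \<omega> k))"
    unfolding F_path by (simp add: noise_expectation[OF kM G])
  finally show ?thesis .
qed

text \<open>Whether the step from \<open>k\<close> to \<open>k + 1\<close> is taken is decided by
  time \<open>k\<close>; this makes the factor admissible in
  \<open>one_step_expectation\<close>.\<close>

lemma stopping_time_not_yet_measurable: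
  assumes "\<nu> \<in> stopping_times n M"
  shows "(\<lambda>y. of_bool (k < \<nu> y) :: real) \<in> borel_measurable (path_filtration n k)"
proof -
  have "Measurable.pred (path_filtration n k) (\<lambda>y. k < \<nu> y)"
    using assms by (auto simp: stopping_times_def intro: stopping_timeD2)
  then show ?thesis by measurable
qed

text \<open>A discrete Dynkin formula: telescope the candidate value up to the stopping time and
  replace each increment by its conditional mean.\<close>

lemma expectation_from_optimal_value:
  assumes \<nu>: "\<nu> \<in> stopping_times n M" and "n \<le> M"
  shows "integrable P (\<lambda>\<omega>. optimal_value (M - \<nu> (\<lambda>j. ou_path a \<delta> w n x j \<omega>))
           (ou_path a \<delta> w n x (\<nu> (\<lambda>j. ou_path a \<delta> w n x j \<omega>)) \<omega>))" (is ?int)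
    and "expectation_from P a \<delta> w n x (\<lambda>y. optimal_value (M - \<nu> y) (y (\<nu> y))) =
      optimal_value (M - n) x + (\<Sum>k = n..<M. expectation_from P a \<delta> w n x (\<lambda>y. of_bool (k < \<nu> y) *
        (transition (optimal_value (M - Suc k)) (y k) - optimal_value (M - k) (y k))))" (is ?eq)
proof -
  let ?p = "\<lambda>\<omega> j. ou_path a \<delta> w n x j \<omega>"
  let ?U = "\<lambda>k \<omega>. optimal_value (M - k) (?p \<omega> k)"
  let ?A = "\<lambda>k \<omega>. of_bool (k < \<nu> (?p \<omega>)) :: real"
  let ?C = "\<lambda>k \<omega>. transition (optimal_value (M - Suc k)) (?p \<omega> k)"
  have \<nu>_bounds: "n \<le> \<nu> y" "\<nu> y \<le> M" for y using \<nu> by (auto simp: stopping_times_def)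
  have U: "integrable P (?U k)" if "k \<le> M" for k
    using that by (rule optimal_value_integrable)
  have [measurable]: "?A k \<in> borel_measurable P" if "k < M" for k
    using that
    by (intro measurable_compose[OF measurable_into_path_filtration stopping_time_not_yet_measurable[OF \<nu>]]
        ou_path_measurable) auto
  have restricted: "integrable P (\<lambda>\<omega>. ?A k \<omega> * g \<omega>)" if "integrable P g" "k < M" for g k
  proof (rule Bochner_Integration.integrable_bound[OF that(1)])
    show "(\<lambda>\<omega>. ?A k \<omega> * g \<omega>) \<in> borel_measurable P" using that by measurable
  qed auto
  have C: "integrable P (?C k)" if "k < M" for k
    using that by (intro transition_optimal_value_integrable) simp
  have split: "optimal_value (M - \<nu> (?p \<omega>)) (?p \<omega> (\<nu> (?p \<omega>))) =
      ?U n \<omega> + (\<Sum>k = n..<M. ?A k \<omega> * (?U (Suc k) \<omega> - ?U k \<omega>))" for \<omega>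
    by (rule telescope_until) (use \<nu>_bounds in auto)
  have step_int: "integrable P (\<lambda>\<omega>. ?A k \<omega> * (?U (Suc k) \<omega> - ?U k \<omega>))" if "k < M" for k
    using that by (intro restricted Bochner_Integration.integrable_diff U) auto
  have sum_int: "integrable P (\<lambda>\<omega>. \<Sum>k = n..<M. ?A k \<omega> * (?U (Suc k) \<omega> - ?U k \<omega>))"
    by (intro Bochner_Integration.integrable_sum step_int) simp
  show ?int
    unfolding split by (rule Bochner_Integration.integrable_add[OF U[OF \<open>n \<le> M\<close>] sum_int])
  \<comment> \<open>Only the value at \<open>k + 1\<close> has to be averaged; the value at
    \<open>k\<close> is already a function of the past.\<close>
  have step: "expectation (\<lambda>\<omega>. ?A k \<omega> * (?U (Suc k) \<omega> - ?U k \<omega>)) =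
      expectation (\<lambda>\<omega>. ?A k \<omega> * (?C k \<omega> - ?U k \<omega>))" if k: "n \<le> k" "k < M" for k
  proof -
    have U': "integrable P (\<lambda>\<omega>. ?A k \<omega> * ?U (Suc k) \<omega>)" "integrable P (\<lambda>\<omega>. ?A k \<omega> * ?U k \<omega>)"
      by (rule restricted[OF U], use k in linarith, use k in linarith)+
    have "expectation (\<lambda>\<omega>. ?A k \<omega> * ?U (Suc k) \<omega>) = expectation (\<lambda>\<omega>. ?A k \<omega> * ?C k \<omega>)"
      by (rule one_step_expectation[OF k stopping_time_not_yet_measurable[OF \<nu>]
          optimal_value_measurable U'(1)])
    then show ?thesis
      using U' restricted[OF C k(2)] k by (simp only: right_diff_distrib Bochner_Integration.integral_diff)
  qed
  have U_n: "?U n \<omega> = optimal_value (M - n) x" for \<omega> by (simp add: ou_path_before)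
  have "expectation_from P a \<delta> w n x (\<lambda>y. optimal_value (M - \<nu> y) (y (\<nu> y))) =
      expectation (?U n) + (\<Sum>k = n..<M. expectation (\<lambda>\<omega>. ?A k \<omega> * (?U (Suc k) \<omega> - ?U k \<omega>)))"
    unfolding expectation_from_def split
      Bochner_Integration.integral_add[OF U[OF \<open>n \<le> M\<close>] sum_int]
    by (subst Bochner_Integration.integral_sum) (rule step_int, simp_all)
  also have "expectation (?U n) = optimal_value (M - n) x" by (simp only: U_n) (simp add: prob_space)
  also have "(\<Sum>k = n..<M. expectation (\<lambda>\<omega>. ?A k \<omega> * (?U (Suc k) \<omega> - ?U k \<omega>))) =
      (\<Sum>k = n..<M. expectation (\<lambda>\<omega>. ?A k \<omega> * (?C k \<omega> - ?U k \<omega>)))"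
    by (rule sum.cong) (simp_all only: step atLeastLessThan_iff)
  finally show ?eq
    unfolding expectation_from_def .
qed

section \<open>The rule that stops at the first nonpositive gain\<close>

text \<open>The disjunct \<open>k = M\<close> forces stopping at the horizon and guarantees that a
  least element exists when n \<le> M. Ties are settled in favour of stopping.\<close>

definition first_stop :: "nat \<Rightarrow> (nat \<Rightarrow> real) \<Rightarrow> nat" where
  "first_stop n y =
     (LEAST k. n \<le> k \<and> (k = M \<or> transition (optimal_value (M - Suc k)) (y k) \<le> weight (M - k) * (y k)\<^sup>2))"

lemma first_stop_properties:
  assumes "n \<le> M"
  shows "n \<le> first_stop n y" "first_stop n y \<le> M"
    and "first_stop n y = M \<or> transition (optimal_value (M - Suc (first_stop n y))) (y (first_stop n y))
      \<le> weight (M - first_stop n y) * (y (first_stop n y))\<^sup>2"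
    and "n \<le> k \<Longrightarrow> k < first_stop n y \<Longrightarrow>
      weight (M - k) * (y k)\<^sup>2 < transition (optimal_value (M - Suc k)) (y k)"
proof -
  let ?Q = "\<lambda>k. n \<le> k \<and> (k = M \<or> transition (optimal_value (M - Suc k)) (y k) \<le> weight (M - k) * (y k)\<^sup>2)"
  have M: "?Q M" using assms by simp
  have "?Q (first_stop n y)" unfolding first_stop_def by (rule LeastI[of ?Q, OF M])
  then show "n \<le> first_stop n y" "first_stop n y = M \<or> transition (optimal_value (M - Suc (first_stop n y))) (y (first_stop n y))
      \<le> weight (M - first_stop n y) * (y (first_stop n y))\<^sup>2" by auto
  show "first_stop n y \<le> M" unfolding first_stop_def by (rule Least_le[of ?Q, OF M])
  show "weight (M - k) * (y k)\<^sup>2 < transition (optimal_value (M - Suc k)) (y k)"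
    if "n \<le> k" "k < first_stop n y"
    using not_less_Least[of k ?Q] that by (auto simp: first_stop_def)
qed

lemma transition_optimal_value_measurable [measurable]:
  "transition (optimal_value j) \<in> borel_measurable borel"
  unfolding transition_optimal_value[abs_def]
  using borel_measurable_continuous_onI[OF gap_continuous, of j] by measurable

lemma first_stop_stopping_time:
  assumes "n \<le> M"
  shows "first_stop n \<in> stopping_times n M"
proof -
  have "Measurable.pred (path_filtration n t) (\<lambda>y. first_stop n y \<le> t)" for t
  proof -
    let ?Q = "\<lambda>y k. k = M \<or> transition (optimal_value (M - Suc k)) (y k) \<le> weight (M - k) * (y k)\<^sup>2"
    \<comment> \<open>The event becomes a finite union of conditions on single coordinates observed
      by time \<open>t\<close>.\<close>
    have eq: "(\<lambda>y. first_stop n y \<le> t) = (\<lambda>y. \<exists>k\<in>{n..t}. ?Q y k)"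
    proof (intro ext iffI)
      fix y assume "first_stop n y \<le> t"
      then show "\<exists>k\<in>{n..t}. ?Q y k"
        using first_stop_properties(1,3)[OF assms, of y] by (intro bexI[of _ "first_stop n y"]) auto
    next
      fix y assume "\<exists>k\<in>{n..t}. ?Q y k"
      then obtain k where k: "n \<le> k" "k \<le> t" "?Q y k" by auto
      then have "first_stop n y \<le> k" unfolding first_stop_def by (intro Least_le) auto
      then show "first_stop n y \<le> t" using k by simp
    qed
    note path_filtration_component [measurable]
    show ?thesis unfolding eq by measurable
  qed
  then show ?thesis
    using first_stop_properties(1,2)[OF assms] by (auto simp: stopping_times_def intro: stopping_timeI)
qed

text \<open>The supermartingale inequality: continuing is one of the two options in
  \<open>optimal_value_Suc\<close>.\<close>

lemma transition_le_optimal_value: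
  "k < M \<Longrightarrow> transition (optimal_value (M - Suc k)) x \<le> optimal_value (M - k) x"
  using optimal_value_Suc[of "M - Suc k" x] by (simp add: Suc_diff_Suc)

text \<open>The candidate dominates the reward at the stopping time, and every conditional increment
  in the Dynkin formula is nonpositive.\<close>

lemma expected_reward_le_optimal_value:
  assumes \<nu>: "\<nu> \<in> stopping_times n M" and n: "n \<le> M"
  shows "expectation_from P a \<delta> w n x (\<lambda>y. sampling_reward a \<delta> M (\<nu> y) (y (\<nu> y))) \<le> optimal_value (M - n) x"
proof -
  have \<nu>_le: "\<nu> y \<le> M" for y using \<nu> by (auto simp: stopping_times_def)
  have "expectation_from P a \<delta> w n x (\<lambda>y. sampling_reward a \<delta> M (\<nu> y) (y (\<nu> y)))
      \<le> expectation_from P a \<delta> w n x (\<lambda>y. optimal_value (M - \<nu> y) (y (\<nu> y)))"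
    unfolding expectation_from_def
    by (rule integral_mono[OF stopped_reward_integrable[OF \<nu>] expectation_from_optimal_value(1)[OF \<nu> n]])
      (simp add: sampling_reward_eq \<nu>_le reward_le_optimal_value)
  also have "\<dots> \<le> optimal_value (M - n) x"
  proof -
    have "expectation_from P a \<delta> w n x (\<lambda>y. of_bool (k < \<nu> y) *
        (transition (optimal_value (M - Suc k)) (y k) - optimal_value (M - k) (y k))) \<le> 0" if "k < M" for k
    proof -
      \<comment> \<open>The sign is reversed so that the nonnegativity of the integrand can be
        used.\<close>
      have "0 \<le> expectation_from P a \<delta> w n x (\<lambda>y. - (of_bool (k < \<nu> y) *
        (transition (optimal_value (M - Suc k)) (y k) - optimal_value (M - k) (y k))))"
        unfolding expectation_from_def
        by (rule Bochner_Integration.integral_nonneg) (simp add: transition_le_optimal_value that)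
      then show ?thesis by (simp add: expectation_from_def)
    qed
    then show ?thesis
      unfolding expectation_from_optimal_value(2)[OF \<nu> n] by (auto intro!: sum_nonpos)
  qed
  finally show ?thesis .
qed

text \<open>Both inequalities of the upper bound become equalities: before the rule stops, the
  maximum in \<open>optimal_value_Suc\<close> is the continuation term; where it stops, the reward;
  at the horizon both values are 0.\<close>

lemma expected_reward_first_stop:
  assumes n: "n \<le> M"
  shows "expectation_from P a \<delta> w n x (\<lambda>y. sampling_reward a \<delta> M (first_stop n y) (y (first_stop n y)))
    = optimal_value (M - n) x"
proof -
  note stop = first_stop_properties[OF n]
  have "sampling_reward a \<delta> M (first_stop n y) (y (first_stop n y)) =
      optimal_value (M - first_stop n y) (y (first_stop n y))" for y
  proof (cases "first_stop n y = M")
    case True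
    then show ?thesis by (simp add: sampling_reward_eq optimal_value_def)
  next
    case False
    then have "first_stop n y < M" using stop(2)[of y] by simp
    then show ?thesis
      using False stop(2,3)[of y] optimal_value_Suc[of "M - Suc (first_stop n y)"]
      by (simp add: sampling_reward_eq Suc_diff_Suc)
  qed
  moreover have "expectation_from P a \<delta> w n x (\<lambda>y. of_bool (k < first_stop n y) *
      (transition (optimal_value (M - Suc k)) (y k) - optimal_value (M - k) (y k))) = 0"
    if "k \<in> {n..<M}" for k
  proof -
    have "of_bool (k < first_stop n y) *
        (transition (optimal_value (M - Suc k)) (y k) - optimal_value (M - k) (y k)) = 0" for y
      using stop(4)[of k y] that optimal_value_Suc[of "M - Suc k" "y k"] by (auto simp: Suc_diff_Suc)
    then show ?thesis by (simp only: expectation_from_def Bochner_Integration.integral_zero)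
  qed
  ultimately show ?thesis
    using expectation_from_optimal_value(2)[OF first_stop_stopping_time[OF n] n, of x] by simp
qed

section \<open>Identification of the value function, and the thresholds\<close>

lemma value_fun_eq:
  assumes "n \<le> M"
  shows "value_fun P a \<delta> M w n x = optimal_value (M - n) x"
  unfolding value_fun_def
proof (rule cSup_eq_maximum)
  show "optimal_value (M - n) x \<in> stopping_values P a \<delta> M w n x"
    unfolding stopping_values_def
    using expected_reward_first_stop[OF assms, of x] first_stop_stopping_time[OF assms]
    by (intro image_eqI[of _ _ "first_stop n"]) auto
qed (auto simp: stopping_values_def intro: expected_reward_le_optimal_value[OF _ assms])

lemma continuation_value_eq:
  assumes "n < M"
  shows "continuation_value P a \<delta> M w n x = transition (optimal_value (M - Suc n)) x"
  using noise_expectation[OF assms optimal_value_measurable] assms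
  by (simp add: continuation_value_def expectation_from_def value_fun_eq ou_path_before)

text \<open>Turns the comparison of stopping with continuing into the sign of
  \<open>gap\<close>.\<close>

lemma continuation_value_gap:
  assumes "n < M"
  shows "continuation_value P a \<delta> M w n x = gap (M - Suc n) x + sampling_reward a \<delta> M n x"
  using assms by (simp add: continuation_value_eq transition_optimal_value sampling_reward_eq Suc_diff_Suc)

lemma value_fun_horizon: "value_fun P a \<delta> M w M x = 0"
  by (simp add: value_fun_eq optimal_value_def)

text \<open>A Bochner integral defaults to 0 without integrability; this shows that the expectation
  in the Bellman equation is a genuine one.\<close>

lemma value_fun_integrable:
  assumes "n < M"
  shows "integrable P (\<lambda>\<omega>. value_fun P a \<delta> M w (Suc n) (ou_path a \<delta> w n x (Suc n) \<omega>))"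
  using assms optimal_value_integrable[of "Suc n"] by (simp only: value_fun_eq Suc_leI)

lemma bellman_equation:
  assumes "n < M"
  shows "value_fun P a \<delta> M w n x = max (sampling_reward a \<delta> M n x) (continuation_value P a \<delta> M w n x)"
  using assms optimal_value_Suc[of "M - Suc n" x]
  by (simp add: value_fun_eq continuation_value_eq sampling_reward_eq Suc_diff_Suc)

lemma threshold_policy:
  assumes "n \<le> M"
  shows "\<exists>threshold\<ge>0. \<forall>x. (threshold \<le> \<bar>x\<bar> \<longrightarrow> optimal_to_stop P a \<delta> M w n x) \<and>
      (\<bar>x\<bar> < threshold \<longrightarrow> optimal_to_continue P a \<delta> M w n x)"
proof (cases "n = M")
  case True
  \<comment> \<open>Threshold 0 leaves no state in which continuing would be required.\<close>
  then show ?thesis by (intro exI[of _ 0]) (simp add: optimal_to_stop_def)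
next
  case False
  then have n: "n < M" using assms by simp
  obtain b where "gap (M - Suc n) b \<le> 0" using gap_eventually_nonpos by blast
  from threshold_exists[OF gap_continuous gap_antimono this] obtain t where
    "0 \<le> t" "\<And>x. t \<le> \<bar>x\<bar> \<Longrightarrow> gap (M - Suc n) x \<le> 0" "\<And>x. \<bar>x\<bar> < t \<Longrightarrow> 0 \<le> gap (M - Suc n) x"
    by blast
  then show ?thesis
    using n by (intro exI[of _ t]) (simp add: optimal_to_stop_def optimal_to_continue_def continuation_value_gap)
qed

end

theorem mainTheorem5:
  fixes P :: "'a measure" and a \<delta> :: real and M :: nat and X w :: "nat \<Rightarrow> 'a \<Rightarrow> real"
  assumes "ou_chain P a \<delta> M X w"
  shows "(\<forall>x. value_fun P a \<delta> M w M x = 0) \<and>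
    (\<forall>n<M. \<forall>x.
      integrable P (\<lambda>\<omega>. value_fun P a \<delta> M w (Suc n) (ou_path a \<delta> w n x (Suc n) \<omega>)) \<and>
      value_fun P a \<delta> M w n x =
        max (sampling_reward a \<delta> M n x)
            (expectation_from P a \<delta> w n x (\<lambda>y. value_fun P a \<delta> M w (Suc n) (y (Suc n))))) \<and>
    (\<forall>n\<le>M. \<exists>threshold\<ge>0. \<forall>x.
      (threshold \<le> \<bar>x\<bar> \<longrightarrow> optimal_to_stop P a \<delta> M w n x) \<and>
      (\<bar>x\<bar> < threshold \<longrightarrow> optimal_to_continue P a \<delta> M w n x))"
proof -
  interpret ou_chain P a \<delta> M X w by (rule assms)
  show ?thesis
    using value_fun_horizon value_fun_integrable bellman_equation[unfolded continuation_value_def]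
      threshold_policy by blast
qed

end
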